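(* For all positive integers $n,k$ and $m$ with $1 \leq m \leq n-2$ and $1 \leq k \leq n-1$, we have $$p^{DU}_{n,m,k}+p^{UD}_{n,m,k+1}=p^{DU}_{n,m+1,k}+p^{UD}_{n,m+1,k+1}=\frac{2}{n-1}\binom{n-1}{k-1}\binom{n-1}{k+1}.$$
   Context: Let $\mathcal{L}_n$ be the set of lattice paths in $\mathbb{Z}\times\mathbb{Z}$ from $(0,0)$ to $(n,n)$ using up steps $U=(0,1)$ and down steps $D=(1,0)$. A path is identified with a word of length $2n$ in the letters $U, D$ (with $n$ of each). An up step lies below the line $y=x$ if it goes from $(a,b)$ to $(a,b+1)$ with $b<a$. An $(n,m)$-Dyck path is a path in $\mathcal{L}_n$ with exactly $m$ up steps below the line $y=x$. A peak of a path is an occurrence of two consecutive steps $UD$. $\mathcal{P}_{n,m,k}$ denotes the set of all $(n,m)$-Dyck paths with exactly $k$ peaks. For $A,B\in\{U,D\}$, $\mathcal{P}^{AB}_{n,m,k}$ denotes the set of paths in $\mathcal{P}_{n,m,k}$ whose first step is $A$ and whose last step is $B$, and $p^{AB}_{n,m,k}=|\mathcal{P}^{AB}_{n,m,k}|$. Binomial coefficients $\binom{a}{b}$ with $b>a\ge 0$ are $0$. *)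

theory Defs
  imports Complex_Main
begin

datatype step = U | D

fun move :: "step \<Rightarrow> int \<times> int \<Rightarrow> int \<times> int" where
  "move U (a, b) = (a, b + 1)"
| "move D (a, b) = (a + 1, b)"

text \<open>The lattice point reached from the origin by the first \<open>i\<close> steps of \<open>w\<close>.\<close>

definition vertex :: "step list \<Rightarrow> nat \<Rightarrow> int \<times> int" where
  "vertex w i = fold move (take i w) (0, 0)"

definition lattice_paths :: "nat \<Rightarrow> step list set" where
  "lattice_paths n = {w. vertex w (length w) = (int n, int n)}"

definition up_below :: "step list \<Rightarrow> nat" where
  "up_below w =
     card {i. i < length w \<and> w ! i = U \<and> snd (vertex w i) < fst (vertex w i)}"

definition peaks :: "step list \<Rightarrow> nat" where
  "peaks w = card {i. Suc i < length w \<and> w ! i = U \<and> w ! Suc i = D}"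

definition dyck_paths :: "nat \<Rightarrow> nat \<Rightarrow> step list set" where
  "dyck_paths n m = {w \<in> lattice_paths n. up_below w = m}"

definition P :: "nat \<Rightarrow> nat \<Rightarrow> nat \<Rightarrow> step list set" where
  "P n m k = {w \<in> dyck_paths n m. peaks w = k}"

definition P_ends :: "step \<Rightarrow> step \<Rightarrow> nat \<Rightarrow> nat \<Rightarrow> nat \<Rightarrow> step list set" where
  "P_ends A B n m k = {w \<in> P n m k. w \<noteq> [] \<and> hd w = A \<and> last w = B}"

definition p :: "step \<Rightarrow> step \<Rightarrow> nat \<Rightarrow> nat \<Rightarrow> nat \<Rightarrow> nat" where
  "p A B n m k = card (P_ends A B n m k)"

end

theory Submission imports Defs "HOL-Library.Multiset" begin

text \<open>
  Put \<open>N = n - 1\<close>. A path from \<open>U\<close> to \<open>D\<close> with \<open>k + 1\<close> peaks and a path from \<open>D\<close> to \<open>U\<close> with \<open>k\<close> peaks both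
  consist of \<open>k + 1\<close> runs of each letter. For a given first letter, such a path is determined by the positions
  at which its runs end, that is, by two subsets of \<open>{1..N}\<close> with \<open>k\<close> elements each, one for the down
  steps and one for the up steps. Reading the two indicator functions column by column gives a bridge: a
  walk of length \<open>N\<close> from 0 to 0 with steps \<open>1\<close>, \<open>-1\<close> and two kinds of level step. The number of up steps
  below the diagonal is the number of positions, among \<open>0, ..., N\<close>, where the bridge is negative if the path
  starts with \<open>U\<close>, and where it is at most 0 if the path starts with \<open>D\<close> (\<open>below_word_of\<close>). By
  reflection, each of the two sums in the theorem therefore counts the bridges with \<open>m\<close> and those with
  \<open>N + 1 - m\<close> negative positions (with \<open>m + 1\<close> for \<open>m\<close> in the second sum) (\<open>p_UD\<close>, \<open>p_DU\<close>).

  A bijection in the style of Sparre Andersen rearranges the columns so that the number of negative positions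
  becomes the position of the first minimum (\<open>card_dips_eq\<close>). Rotating a bridge at its first minimum,
  without the step that reaches the minimum, gives a nonnegative walk of length \<open>N - 1\<close> from 0 to 1, that
  is, a pair \<open>(X, Y)\<close> of excursions with an up step between them. The position \<open>m\<close> only enters
  through the condition that \<open>X\<close> is shorter than \<open>N - m\<close> (\<open>card_cuts\<close>). The condition for \<open>N + 1 - m\<close>
  is the complementary one after an exchange of \<open>X\<close> and \<open>Y\<close>. So the sum of the two counts is the number of
  all pairs, whatever \<open>m\<close> is (\<open>card_dips_add\<close>), and this is the number of nonnegative walks of length
  \<open>N - 1\<close> from 0 to 1 whose columns mark \<open>k\<close> run ends of \<open>D\<close>, which is a difference of products of binomial
  coefficients (\<open>nonneg_count_eq\<close>, \<open>card_meanders_to_one\<close>).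
\<close>

section \<open>Run ends of a word\<close>

lemma card_lessThan_Suc_shift:
  "card {i. i < Suc n \<and> Q i} = of_bool (Q 0) + card {i. i < n \<and> Q (Suc i)}"
proof -
  have "{i. i < Suc n \<and> Q i} = (if Q 0 then {0} else {}) \<union> Suc ` {i. i < n \<and> Q (Suc i)}"
    by (auto simp: image_iff less_Suc_eq_0_disj)
  moreover have "card ((if Q 0 then {0} else {}) \<union> Suc ` {i. i < n \<and> Q (Suc i)}) =
      of_bool (Q 0) + card {i. i < n \<and> Q (Suc i)}"
    by (subst card_Un_disjoint) (auto simp: card_image)
  ultimately show ?thesis by simp
qed

abbreviation trues :: "bool list \<Rightarrow> nat" where
  "trues xs \<equiv> count_list xs True"

fun opp :: "step \<Rightarrow> step" where "opp U = D" | "opp D = U"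

lemma opp_simps [simp]: "opp (opp s) = s" "opp s \<noteq> s" "s \<noteq> opp s"
  by (cases s; simp)+

text \<open>
  The entry of index \<open>v\<close> belongs to the letter \<open>s\<close> number \<open>v + 1\<close> of the word; it is true if a maximal
  run of \<open>s\<close> ends there. The end of the word counts as the end of a run, which makes the last entry
  true for both letters and lets the two letters be treated alike.
\<close>

primrec run_ends :: "step \<Rightarrow> step list \<Rightarrow> bool list" where
  "run_ends s [] = []"
| "run_ends s (x # w) =
     (if x = s then (w = [] \<or> hd w \<noteq> s) # run_ends s w else run_ends s w)"

lemma length_run_ends: "length (run_ends s w) = count_list w s"
  by (induction w) auto

lemma last_run_ends: "run_ends s w \<noteq> [] \<Longrightarrow> last (run_ends s w)"
proof (induction w)
  case (Cons x w)
  show ?case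
  proof (cases "run_ends s w = []")
    case True
    then have "s \<notin> set w"
      by (metis count_list_0_iff length_0_conv length_run_ends)
    then show ?thesis using Cons True by (cases w) (auto split: if_splits)
  qed (use Cons in auto)
qed simp

text \<open>The runs of the two letters alternate, beginning with the first letter of the word.\<close>

lemma trues_run_ends_hd:
  "w \<noteq> [] \<Longrightarrow> trues (run_ends (hd w) w) =
     trues (run_ends (opp (hd w)) w) + of_bool (last w = hd w)"
proof (induction w)
  case (Cons x w)
  show ?case
  proof (cases w)
    case Nil
    then show ?thesis by (cases x) auto
  next
    case (Cons y w')
    then show ?thesis using Cons.IH by (cases x; cases y; cases "last w'") auto
  qed
qed simp

lemma peaks_Cons:
  "peaks (x # w) = of_bool (x = U \<and> w \<noteq> [] \<and> hd w = D) + peaks w"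
proof -
  have "peaks (x # w) = card {i. i < Suc (length w) \<and>
      (i < length w \<and> (x # w) ! i = U \<and> (x # w) ! Suc i = D)}"
    unfolding peaks_def by (rule arg_cong[where f = card]) auto
  also have "\<dots> = of_bool (0 < length w \<and> x = U \<and> w ! 0 = D) +
      card {i. i < length w \<and> (Suc i < length w \<and> w ! i = U \<and> w ! Suc i = D)}"
    by (subst card_lessThan_Suc_shift) simp
  also have "{i. i < length w \<and> (Suc i < length w \<and> w ! i = U \<and> w ! Suc i = D)} =
      {i. Suc i < length w \<and> w ! i = U \<and> w ! Suc i = D}" by auto
  finally show ?thesis by (cases w) (auto simp: peaks_def)
qed

text \<open>
  Every run of \<open>U\<close> ends in a peak, except a run at the end of the word. So a word from \<open>D\<close> to \<open>U\<close> with
  \<open>k\<close> peaks and a word from \<open>U\<close> to \<open>D\<close> with \<open>k + 1\<close> peaks have the same number \<open>k + 1\<close> of runs of each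
  letter. This is why the two families belong together.
\<close>

lemma trues_run_ends_U: "trues (run_ends U w) = peaks w + of_bool (w \<noteq> [] \<and> last w = U)"
proof (induction w)
  case Nil then show ?case by (simp add: peaks_def)
next
  case (Cons x w)
  show ?case
  proof (cases w)
    case Nil
    then show ?thesis by (cases x) (auto simp: peaks_Cons, simp_all add: peaks_def)
  next
    case (Cons y w')
    then show ?thesis using Cons.IH by (cases x; cases y) (auto simp: peaks_Cons)
  qed
qed

lemma vertex_eq: "vertex w i = (int (count_list (take i w) D), int (count_list (take i w) U))"
proof -
  have "fold move v (a, b) = (a + int (count_list v D), b + int (count_list v U))" for v a b
  proof (induction v arbitrary: a b)
    case (Cons x v)
    then show ?case by (cases x) auto
  qed simp
  then show ?thesis by (simp add: vertex_def)
qed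

lemma lattice_paths_iff: "w \<in> lattice_paths n \<longleftrightarrow> count_list w U = n \<and> count_list w D = n"
  by (auto simp: lattice_paths_def vertex_eq)

text \<open>The path starts at a point with \<open>x - y = d\<close>, so that the count can be peeled from the front.\<close>

definition up_below_from :: "int \<Rightarrow> step list \<Rightarrow> nat" where
  "up_below_from d w = card {i. i < length w \<and> w ! i = U \<and>
     int (count_list (take i w) U) < d + int (count_list (take i w) D)}"

lemma up_below_eq: "up_below w = up_below_from 0 w"
  by (simp add: up_below_def up_below_from_def vertex_eq)

lemma up_below_from_Cons:
  "up_below_from d (U # w) = of_bool (0 < d) + up_below_from (d - 1) w"
  "up_below_from d (D # w) = up_below_from (d + 1) w"
  by (simp_all add: up_below_from_def card_lessThan_Suc_shift algebra_simps)

text \<open>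
  Consider the up step number \<open>v + 1\<close> of a path that starts in the origin (\<open>d = 0\<close>). It lies below the
  diagonal if at least \<open>v + 1\<close> down steps precede it. The down steps that precede it are whole runs,
  one for each earlier end of a run of \<open>U\<close> (and one more if the path starts with \<open>D\<close>), so this says
  that fewer runs of \<open>D\<close> have ended within the first \<open>v\<close> down steps than have been completed before
  that up step. For general \<open>d\<close> the two lists of run ends are shifted against each other by \<open>d\<close>, which
  is what an induction over the word needs.
\<close>

lemma up_below_from_run_ends:
  assumes "w \<noteq> []"
  shows "up_below_from d w = card {i. i < length (run_ends U w) \<and>
     (int i < d \<or> trues (take (nat (int i - d)) (run_ends D w))
        < trues (take i (run_ends U w)) + of_bool (hd w = D))}"
  using assms
proof (induction w arbitrary: d)
  case (Cons x w)
  show ?case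
  proof (cases "w = []")
    case True
    have "{i. i < Suc 0 \<and> Q i} = (if Q 0 then {0} else {})" for Q by auto
    then show ?thesis using True by (cases x) (simp_all add: up_below_from_Cons up_below_from_def)
  next
    case False
    note IH = Cons.IH[OF False]
    show ?thesis
    proof (cases x)
      case U
      then show ?thesis using False
        by (cases "hd w")
          (auto simp: up_below_from_Cons IH card_lessThan_Suc_shift algebra_simps
            intro!: arg_cong[where f = card])
    next
      case D
      \<comment> \<open>Peeling a down step moves the two lists against each other by one: its run end \<open>b\<close> is the
        first entry of the list of down steps, and \<open>b\<close> decides which letter comes next.\<close>
      have *: "(int i < d \<or> trues (take (nat (int i - d)) (b # ys)) < z + 1) \<longleftrightarrow>
         (int i < d + 1 \<or> trues (take (nat (int i - (d + 1))) ys) < z + of_bool (\<not> b))" for i b ys z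
      proof (cases "int i \<le> d")
        case False
        then have "nat (int i - d) = Suc (nat (int i - (d + 1)))" by linarith
        then show ?thesis using False by auto
      qed auto
      show ?thesis using False D
        by (cases "hd w") (simp_all add: up_below_from_Cons IH *[simplified])
    qed
  qed
qed simp

text \<open>
  The word whose runs of \<open>s\<close> and of the other letter end as the two lists say, starting with \<open>s\<close>. At the
  end of a run the letters, and with them the lists, change places.
\<close>

function (sequential) word_of :: "step \<Rightarrow> bool list \<Rightarrow> bool list \<Rightarrow> step list" where
  "word_of s [] ys = []"
| "word_of s (x # xs) ys = s # (if x then word_of (opp s) ys xs else word_of s xs ys)"
  by pat_completeness auto
termination by (relation "measure (\<lambda>(s, xs, ys). length xs + length ys)") auto

lemma word_of_run_ends:
  "w = [] \<or> hd w = s \<Longrightarrow> word_of s (run_ends s w) (run_ends (opp s) w) = w"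
proof (induction w arbitrary: s)
  case (Cons x w)
  show ?case
  proof (cases "w = [] \<or> hd w = opp s")
    case True
    then have "word_of (opp s) (run_ends (opp s) w) (run_ends (opp (opp s)) w) = w"
      by (intro Cons.IH) auto
    then show ?thesis using Cons.prems True by auto
  next
    case False
    then have "hd w = s" by (cases s; cases "hd w") auto
    then show ?thesis using Cons.prems False Cons.IH[of s] by auto
  qed
qed simp

lemma hd_word_of: "xs \<noteq> [] \<Longrightarrow> word_of s xs ys \<noteq> [] \<and> hd (word_of s xs ys) = s"
  by (cases xs) auto

lemma last_imp_trues: "xs \<noteq> [] \<Longrightarrow> last xs \<Longrightarrow> trues xs > 0"
  by (metis (full_types) count_list_0_iff last_in_set neq0_conv)

text \<open>
  The condition on the numbers of runs keeps the decoder from running out of one list while the other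
  still has entries: the list that it reads has as many run ends as the other one, or one more. Using
  up a run end and then exchanging the lists preserves this.
\<close>

lemma run_ends_word_of:
  assumes "xs = [] \<or> last xs" "ys = [] \<or> last ys"
    and "trues xs = trues ys \<or> trues xs = trues ys + 1"
  shows "run_ends s (word_of s xs ys) = xs \<and> run_ends (opp s) (word_of s xs ys) = ys"
  using assms
proof (induction s xs ys rule: word_of.induct)
  case (1 s ys)
  then show ?case using last_imp_trues[of ys] by auto
next
  case (2 s x xs ys)
  show ?case
  proof (cases x)
    case True
    have "run_ends (opp s) (word_of (opp s) ys xs) = ys \<and>
        run_ends (opp (opp s)) (word_of (opp s) ys xs) = xs"
      using 2 True by (intro 2) (auto split: if_splits)
    moreover have "ys = [] \<Longrightarrow> xs = []"
      using 2 True last_imp_trues[of xs] by (auto split: if_splits)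
    ultimately show ?thesis using True hd_word_of[of ys "opp s" xs] by (cases ys) auto
  next
    case False
    have "xs \<noteq> []" using 2 False by auto
    moreover have "run_ends s (word_of s xs ys) = xs \<and> run_ends (opp s) (word_of s xs ys) = ys"
      using 2 False by (intro 2) (auto split: if_splits)
    ultimately show ?thesis using False hd_word_of[of xs s ys] by auto
  qed
qed

section \<open>Paths as bridges of columns\<close>

text \<open>
  The column number \<open>v\<close> tells whether the down step number \<open>v\<close> and whether the up step number \<open>v\<close> of
  a path ends a run, in this order. A list of columns is read as a walk on the integers: \<open>(True, False)\<close> goes up,
  \<open>(False, True)\<close> goes down, and there are two kinds of level step.
\<close>

type_synonym column = "bool \<times> bool"

definition tot :: "column list \<Rightarrow> int" where
  "tot c = int (trues (map fst c)) - int (trues (map snd c))"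

lemma tot_simps [simp]:
  "tot [] = 0" "tot ((a, b) # c) = of_bool a - of_bool b + tot c" "tot (c @ c') = tot c + tot c'"
  by (auto simp: tot_def)

lemma tot_Cons: "tot (s # c) = tot [s] + tot c"
  by (cases s) auto

definition dips :: "column list \<Rightarrow> nat" where
  "dips c = card {i. i \<le> length c \<and> tot (take i c) < 0}"

text \<open>
  Paths to \<open>(N + 1, N + 1)\<close> with \<open>k + 1\<close> runs of each letter give bridges with \<open>N\<close> columns: the run ends
  at the last \<open>U\<close> and at the last \<open>D\<close> carry no information and are dropped.
\<close>

definition bridges :: "nat \<Rightarrow> nat \<Rightarrow> column list set" where
  "bridges N k = {c. length c = N \<and> trues (map fst c) = k \<and> trues (map snd c) = k}"

text \<open>
  This is \<open>up_below_from_run_ends\<close> for \<open>d = 0\<close>, read off the columns. Starting with \<open>U\<close> or with \<open>D\<close> makes the difference between a strict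
  and a weak inequality, and up to a reflection this is all that distinguishes the two kinds of path.
\<close>

lemma below_word_of:
  assumes "c \<in> bridges N k" "xs = map fst c @ [True]" and "ys = map snd c @ [True]"
  shows "up_below (word_of U ys xs) = dips c"
    and "up_below (word_of D xs ys) = card {i. i \<le> N \<and> tot (take i c) \<le> 0}"
proof -
  have len: "length c = N" and eq: "trues xs = trues ys"
    using assms by (auto simp: bridges_def)
  have take: "take i xs = map fst (take i c)" "take i ys = map snd (take i c)" if "i \<le> N" for i
    using that len assms by (auto simp: take_map)
  have U: "run_ends U (word_of U ys xs) = ys" "run_ends D (word_of U ys xs) = xs"
    using run_ends_word_of[of ys xs U] assms eq by auto
  have D: "run_ends D (word_of D xs ys) = xs" "run_ends U (word_of D xs ys) = ys"
    using run_ends_word_of[of xs ys D] assms eq by auto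
  have hd: "word_of U ys xs \<noteq> []" "hd (word_of U ys xs) = U"
    "word_of D xs ys \<noteq> []" "hd (word_of D xs ys) = D"
    using hd_word_of[of ys U xs] hd_word_of[of xs D ys] assms by auto
  have "length ys = Suc N" using assms len by simp
  then have "up_below (word_of U ys xs) = card {i. i \<le> N \<and> trues (take i xs) < trues (take i ys)}"
    by (simp add: up_below_eq up_below_from_run_ends[OF hd(1)] U hd less_Suc_eq_le)
  also have "{i. i \<le> N \<and> trues (take i xs) < trues (take i ys)} =
      {i. i \<le> N \<and> tot (take i c) < 0}"
    using take by (auto simp: tot_def)
  finally show "up_below (word_of U ys xs) = dips c"
    by (simp add: dips_def len)
  have "up_below (word_of D xs ys) = card {i. i \<le> N \<and> trues (take i xs) \<le> trues (take i ys)}"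
    using \<open>length ys = Suc N\<close>
    by (simp add: up_below_eq up_below_from_run_ends[OF hd(3)] D hd less_Suc_eq_le)
  also have "{i. i \<le> N \<and> trues (take i xs) \<le> trues (take i ys)} =
      {i. i \<le> N \<and> tot (take i c) \<le> 0}"
    using take by (auto simp: tot_def)
  finally show "up_below (word_of D xs ys) = card {i. i \<le> N \<and> tot (take i c) \<le> 0}" .
qed

definition walks :: "step \<Rightarrow> nat \<Rightarrow> nat \<Rightarrow> step list set" where
  "walks s N k = {w. w \<noteq> [] \<and> hd w = s \<and> last w = opp s \<and> count_list w s = Suc N \<and>
     count_list w (opp s) = Suc N \<and> trues (run_ends s w) = Suc k}"

lemma bij_betw_bridges_walks:
  "bij_betw (\<lambda>c. word_of s (map fst c @ [True]) (map snd c @ [True])) (bridges N k) (walks s N k)"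
proof (rule bij_betw_byWitness[where f' =
      "\<lambda>w. zip (butlast (run_ends s w)) (butlast (run_ends (opp s) w))"])
  let ?f = "\<lambda>c. word_of s (map fst c @ [True]) (map snd c @ [True])"
  let ?g = "\<lambda>w. zip (butlast (run_ends s w)) (butlast (run_ends (opp s) w))"
  have f: "run_ends s (?f c) = map fst c @ [True]" "run_ends (opp s) (?f c) = map snd c @ [True]"
    "?f c \<noteq> []" "hd (?f c) = s" if "c \<in> bridges N k" for c
    using run_ends_word_of[of "map fst c @ [True]" "map snd c @ [True]" s]
      hd_word_of[of "map fst c @ [True]" s] that by (auto simp: bridges_def)
  show "\<forall>c\<in>bridges N k. ?g (?f c) = c"
    by (simp add: f zip_map_fst_snd)
  show "?f ` bridges N k \<subseteq> walks s N k"
  proof (rule image_subsetI)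
    fix c assume c: "c \<in> bridges N k"
    note f = f[OF c]
    have "last (?f c) \<noteq> s"
      using trues_run_ends_hd[OF f(3)] f c by (auto simp: bridges_def split: if_splits)
    then have "last (?f c) = opp s" by (cases s; cases "last (?f c)") auto
    then show "?f c \<in> walks s N k"
      using f c length_run_ends[of s "?f c"] length_run_ends[of "opp s" "?f c"]
      by (auto simp: walks_def bridges_def)
  qed
  have g: "map fst (?g w) = butlast (run_ends s w)" "map snd (?g w) = butlast (run_ends (opp s) w)"
    "map fst (?g w) @ [True] = run_ends s w" "map snd (?g w) @ [True] = run_ends (opp s) w"
    if "w \<in> walks s N k" for w
  proof -
    have len: "length (run_ends s w) = Suc N" "length (run_ends (opp s) w) = Suc N"
      using that by (auto simp: walks_def length_run_ends)
    then have ne: "run_ends s w \<noteq> []" "run_ends (opp s) w \<noteq> []" by auto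
    show 1: "map fst (?g w) = butlast (run_ends s w)"
      "map snd (?g w) = butlast (run_ends (opp s) w)" using len by auto
    show "map fst (?g w) @ [True] = run_ends s w" "map snd (?g w) @ [True] = run_ends (opp s) w"
      unfolding 1 using ne last_run_ends append_butlast_last_id by metis+
  qed
  show "\<forall>w\<in>walks s N k. ?f (?g w) = w"
    using g word_of_run_ends by (auto simp: walks_def)
  show "?g ` walks s N k \<subseteq> bridges N k"
  proof (rule image_subsetI)
    fix w assume w: "w \<in> walks s N k"
    note g = g[OF w]
    have "trues (run_ends s w) = trues (run_ends (opp s) w)"
      using trues_run_ends_hd[of w] w by (auto simp: walks_def)
    then have "trues (map fst (?g w) @ [True]) = Suc k" "trues (map snd (?g w) @ [True]) = Suc k"
      unfolding g(3,4) using w by (simp_all add: walks_def)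
    then have "trues (map fst (?g w)) = k" "trues (map snd (?g w)) = k"
      unfolding count_list_append by simp_all
    moreover have "length (?g w) = N" using w by (auto simp: walks_def length_run_ends)
    ultimately show "?g w \<in> bridges N k" unfolding bridges_def by blast
  qed
qed

lemma card_bij_filter:
  assumes "bij_betw f A B" "\<And>x. x \<in> A \<Longrightarrow> R (f x) \<longleftrightarrow> Q x"
  shows "card {y \<in> B. R y} = card {x \<in> A. Q x}"
proof -
  have "bij_betw f {x \<in> A. Q x} {y \<in> B. R y}"
    using assms by (auto simp: bij_betw_def inj_on_def)
  then show ?thesis by (metis bij_betw_same_card)
qed

lemma map_swap_components [simp]:
  "map snd (map prod.swap c) = map fst c" "map fst (map prod.swap c) = map snd c"
  by auto

lemma tot_swap: "tot (map prod.swap c) = - tot c"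
  unfolding tot_def map_swap_components by simp

lemma bij_swap_bridges: "bij_betw (map prod.swap) (bridges N k) (bridges N k)"
  by (rule bij_betw_byWitness[where f' = "map prod.swap"])
    (auto simp: bridges_def comp_def)

lemma p_UD: "p U D (Suc N) m (Suc k) = card {c \<in> bridges N k. dips c = m}"
proof -
  have "P_ends U D (Suc N) m (Suc k) = {w \<in> walks U N k. up_below w = m}"
    using trues_run_ends_U
    by (auto simp: P_ends_def P_def dyck_paths_def walks_def lattice_paths_iff)
  \<comment> \<open>The bijection puts the run ends of the first letter first, whereas a column puts those of \<open>D\<close> first.\<close>
  also have "card \<dots> = card {c \<in> bridges N k. dips (map prod.swap c) = m}"
  proof (rule card_bij_filter[OF bij_betw_bridges_walks])
    fix c assume "c \<in> bridges N k"
    then have "map prod.swap c \<in> bridges N k" using bij_swap_bridges bij_betwE by blast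
    from below_word_of(1)[OF this refl refl]
    show "up_below (word_of U (map fst c @ [True]) (map snd c @ [True])) = m \<longleftrightarrow>
        dips (map prod.swap c) = m" unfolding map_swap_components by simp
  qed
  also have "\<dots> = card {c \<in> bridges N k. dips c = m}"
    by (rule card_bij_filter[OF bij_swap_bridges, symmetric]) simp
  finally show ?thesis unfolding p_def .
qed

text \<open>
  Reflecting the bridge turns its \<open>m\<close> prefixes of total at most 0 into the \<open>m\<close> prefixes of total at
  least 0. The remaining ones of the \<open>N + 1\<close> prefixes are the dips.
\<close>

lemma p_DU:
  assumes "m \<le> Suc N"
  shows "p D U (Suc N) m k = card {c \<in> bridges N k. dips c = Suc N - m}"
proof -
  have "P_ends D U (Suc N) m k = {w \<in> walks D N k. up_below w = m}"
  proof (intro equalityI subsetI)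
    fix w assume "w \<in> P_ends D U (Suc N) m k"
    then show "w \<in> {w \<in> walks D N k. up_below w = m}"
      using trues_run_ends_hd[of w] trues_run_ends_U[of w]
      by (simp add: P_ends_def P_def dyck_paths_def walks_def lattice_paths_iff)
  next
    fix w assume "w \<in> {w \<in> walks D N k. up_below w = m}"
    then show "w \<in> P_ends D U (Suc N) m k"
      using trues_run_ends_hd[of w] trues_run_ends_U[of w]
      by (simp add: P_ends_def P_def dyck_paths_def walks_def lattice_paths_iff)
  qed
  also have "card \<dots> = card {c \<in> bridges N k. dips (map prod.swap c) = Suc N - m}"
  proof (rule card_bij_filter[OF bij_betw_bridges_walks])
    fix c assume c: "c \<in> bridges N k"
    then have len: "length c = N" by (auto simp: bridges_def)
    let ?A = "{i. i \<le> N \<and> tot (take i c) \<le> 0}" and ?B = "{i. i \<le> N \<and> \<not> tot (take i c) \<le> 0}"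
    have "card ?A + card ?B = card (?A \<union> ?B)"
      by (rule card_Un_disjoint[symmetric]) auto
    also have "?A \<union> ?B = {..N}" by auto
    finally have "card ?A + card ?B = Suc N" by simp
    moreover have "dips (map prod.swap c) = card {i. i \<le> N \<and> \<not> tot (take i c) \<le> 0}"
      by (simp add: dips_def len take_map tot_swap not_le)
    ultimately show "up_below (word_of D (map fst c @ [True]) (map snd c @ [True])) = m \<longleftrightarrow>
        dips (map prod.swap c) = Suc N - m"
      using below_word_of(2)[OF c refl refl] assms by auto
  qed
  also have "\<dots> = card {c \<in> bridges N k. dips c = Suc N - m}"
    by (rule card_bij_filter[OF bij_swap_bridges, symmetric]) simp
  finally show ?thesis unfolding p_def .
qed

section \<open>Dips become the position of the first minimum\<close>

lemma tot_rev: "tot (rev c) = tot c"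
  by (simp add: tot_def rev_map[symmetric])

definition prefixes_nonneg :: "column list \<Rightarrow> bool" where
  "prefixes_nonneg v \<longleftrightarrow> (\<forall>x y. v = x @ y \<longrightarrow> 0 \<le> tot x)"

text \<open>If \<open>u\<close> has this property and \<open>v\<close> the previous one, then \<open>u @ v\<close> has its first minimum after \<open>u\<close>.\<close>

definition suffixes_neg :: "column list \<Rightarrow> bool" where
  "suffixes_neg u \<longleftrightarrow> (\<forall>x y. u = x @ y \<longrightarrow> y \<noteq> [] \<longrightarrow> tot y < 0)"

lemma prefixes_nonneg_D: "prefixes_nonneg (x @ y) \<Longrightarrow> 0 \<le> tot x"
  unfolding prefixes_nonneg_def by blast

lemma prefixes_nonneg_append: "prefixes_nonneg (x @ y) \<longleftrightarrow> prefixes_nonneg x \<and> (\<forall>z z'. y = z @ z' \<longrightarrow> 0 \<le> tot x + tot z)"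
proof (intro iffI conjI allI impI)
  assume xy: "prefixes_nonneg (x @ y)"
  show "prefixes_nonneg x" unfolding prefixes_nonneg_def
  proof (intro allI impI)
    fix a b assume "x = a @ b"
    then show "0 \<le> tot a" using xy prefixes_nonneg_D[of a "b @ y"] by simp
  qed
  fix z z' assume "y = z @ z'"
  then show "0 \<le> tot x + tot z" using xy prefixes_nonneg_D[of "x @ z" z'] by simp
next
  assume *: "prefixes_nonneg x \<and> (\<forall>z z'. y = z @ z' \<longrightarrow> 0 \<le> tot x + tot z)"
  show "prefixes_nonneg (x @ y)" unfolding prefixes_nonneg_def
  proof (intro allI impI)
    fix a b assume "x @ y = a @ b"
    then consider us where "x = a @ us" | us where "a = x @ us" "y = us @ b"
      unfolding append_eq_append_conv2 by metis
    then show "0 \<le> tot a"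
    proof cases
      case 1
      then show ?thesis using * prefixes_nonneg_D by blast
    next
      case 2
      then show ?thesis using * by simp
    qed
  qed
qed

lemma prefixes_nonneg_tot: "prefixes_nonneg x \<Longrightarrow> 0 \<le> tot x"
  using prefixes_nonneg_D[of x "[]"] by simp

lemma prefixes_nonneg_Nil [simp]: "prefixes_nonneg []"
  by (simp add: prefixes_nonneg_def)

lemma prefixes_nonneg_snoc: "prefixes_nonneg (x @ [s]) \<longleftrightarrow> prefixes_nonneg x \<and> 0 \<le> tot (x @ [s])"
  using prefixes_nonneg_tot[of x] by (auto simp: prefixes_nonneg_append append_eq_Cons_conv Cons_eq_append_conv)

lemma suffixes_neg_Nil [simp]: "suffixes_neg []"
  by (simp add: suffixes_neg_def)

lemma suffixes_neg_Cons: "suffixes_neg (s # u) \<longleftrightarrow> suffixes_neg u \<and> tot (s # u) < 0"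
  unfolding suffixes_neg_def by (auto simp: Cons_eq_append_conv)

lemma suffixes_neg_snoc_down: "suffixes_neg (x @ [(False, True)]) \<longleftrightarrow> (\<forall>y z. x = y @ z \<longrightarrow> tot z \<le> 0)"
proof (induction x)
  case (Cons s x)
  have "(\<forall>y z. s # x = y @ z \<longrightarrow> tot z \<le> 0) \<longleftrightarrow>
      tot (s # x) \<le> 0 \<and> (\<forall>y z. x = y @ z \<longrightarrow> tot z \<le> 0)"
    by (fastforce simp: Cons_eq_append_conv)
  moreover have "tot (s # x @ [(False, True)]) = tot (s # x) - 1"
    using tot_simps(3)[of "s # x" "[(False, True)]"] by simp
  ultimately show ?case using Cons by (auto simp: suffixes_neg_Cons)
qed (simp add: suffixes_neg_Cons)

lemma suffixes_neg_imp_snoc_down: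
  assumes "suffixes_neg u" "u \<noteq> []" obtains x where "u = x @ [(False, True)]"
proof -
  from assms(2) obtain x s where u: "u = x @ [s]" by (metis rev_exhaust)
  then have "tot [s] < 0" using assms(1) unfolding suffixes_neg_def by blast
  then have "s = (False, True)" by (cases s) (auto split: if_splits)
  then show ?thesis using u that by blast
qed

text \<open>
  The columns of a walk are moved apart: those that lead to a negative total go, in reverse order, into
  the first part, and the others, in order, into the second part. The argument of \<open>rearr_rev\<close>
  is the reversed walk, so that the recursion takes off its last column.
\<close>

primrec rearr_rev :: "column list \<Rightarrow> column list \<times> column list" where
  "rearr_rev [] = ([], [])"
| "rearr_rev (s # c) = (if tot (s # c) < 0 then (s # fst (rearr_rev c), snd (rearr_rev c))
     else (fst (rearr_rev c), snd (rearr_rev c) @ [s]))"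

definition rearr :: "column list \<Rightarrow> column list \<times> column list" where
  "rearr c = rearr_rev (rev c)"

lemma rearr_Nil [simp]: "rearr [] = ([], [])"
  by (simp add: rearr_def)

lemma rearr_snoc: "rearr (c @ [s]) = (if tot (c @ [s]) < 0
    then (s # fst (rearr c), snd (rearr c)) else (fst (rearr c), snd (rearr c) @ [s]))"
  using tot_rev[of "c @ [s]"] by (simp add: rearr_def)

lemma dips_snoc: "dips (c @ [s]) = dips c + of_bool (tot (c @ [s]) < 0)"
proof -
  have "{i. i \<le> length (c @ [s]) \<and> tot (take i (c @ [s])) < 0} =
      {i. i \<le> length c \<and> tot (take i c) < 0} \<union>
      (if tot (c @ [s]) < 0 then {Suc (length c)} else {})"
    by (auto simp: le_Suc_eq)
  then show ?thesis unfolding dips_def by (simp add: card_insert_if)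
qed

lemma rearr_mset: "mset (fst (rearr c) @ snd (rearr c)) = mset c"
  by (induction c rule: rev_induct) (auto simp: rearr_snoc)

lemma tot_mset: "mset c = mset c' \<Longrightarrow> tot c = tot c'"
  unfolding tot_def by (metis count_mset mset_map)

lemma length_rearr: "length (fst (rearr c)) = dips c"
  by (induction c rule: rev_induct) (auto simp: rearr_snoc dips_snoc, simp add: dips_def)

lemma rearr_tot: "tot (fst (rearr c)) + tot (snd (rearr c)) = tot c"
  using tot_mset[OF rearr_mset[of c]] by simp

text \<open>
  The two parts together have the total of the walk. If the new total is negative, then so is that of the
  enlarged first part, because the second part is nonnegative; if it is not, then the enlarged second
  part is nonnegative, because the first part is at most 0.
\<close>

lemma rearr_parts: "suffixes_neg (fst (rearr c)) \<and> prefixes_nonneg (snd (rearr c))"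
proof (induction c rule: rev_induct)
  case (snoc s c)
  have "tot (fst (rearr c)) \<le> 0" using snoc
    by (cases "fst (rearr c)") (auto simp: suffixes_neg_Cons)
  moreover have "0 \<le> tot (snd (rearr c))" using snoc prefixes_nonneg_tot by blast
  ultimately show ?case using snoc rearr_tot[of c] tot_Cons[of s "fst (rearr c)"]
    by (auto simp: rearr_snoc suffixes_neg_Cons prefixes_nonneg_snoc)
qed simp

text \<open>
  The total of the walk can be read from the two parts, and its sign tells which of them received the
  last column. So the rearrangement can be undone column by column.
\<close>

lemma rearr_inj: "rearr c = rearr c' \<Longrightarrow> c = c'"
proof (induction c arbitrary: c' rule: rev_induct)
  case Nil
  then show ?case using rearr_mset[of c'] Nil[symmetric] by simp
next
  case (snoc s c)
  have t: "tot (c @ [s]) = tot c'"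
    using rearr_tot[of "c @ [s]"] rearr_tot[of c'] snoc.prems by simp
  have "c' \<noteq> []" using snoc.prems rearr_mset[of "c @ [s]"] by auto
  then obtain d r where c': "c' = d @ [r]" by (metis rev_exhaust)
  have "rearr c = rearr d \<and> s = r"
    using snoc.prems t unfolding c' by (auto simp: rearr_snoc prod_eq_iff split: if_splits)
  then show ?case using snoc.IH c' by auto
qed

lemma rearr_surj: "suffixes_neg u \<Longrightarrow> prefixes_nonneg v \<Longrightarrow> \<exists>c. rearr c = (u, v)"
proof (induction "length u + length v" arbitrary: u v rule: less_induct)
  case less
  show ?case
  proof (cases "tot u + tot v < 0")
    case True
    then have "u \<noteq> []" using prefixes_nonneg_tot[OF less.prems(2)] by auto
    then obtain s u' where u: "u = s # u'" by (cases u) auto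
    then obtain c where c: "rearr c = (u', v)" using less by (auto simp: suffixes_neg_Cons)
    have "tot (c @ [s]) < 0" using rearr_tot[of c] c True u tot_Cons[of s u'] by simp
    then have "rearr (c @ [s]) = (u, v)" by (simp add: rearr_snoc c u)
    then show ?thesis by blast
  next
    case False
    show ?thesis
    proof (cases v rule: rev_cases)
      case Nil
      then have "u = []" using False less.prems by (cases u) (auto simp: suffixes_neg_Cons)
      then show ?thesis using Nil rearr_Nil by blast
    next
      case (snoc v' s)
      then obtain c where c: "rearr c = (u, v')" using less by (auto simp: prefixes_nonneg_snoc)
      have "\<not> tot (c @ [s]) < 0" using rearr_tot[of c] c False snoc by simp
      then have "rearr (c @ [s]) = (u, v)" by (simp add: rearr_snoc c snoc)
      then show ?thesis by blast
    qed
  qed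
qed

text \<open>Bridges cut at their first minimum, which is reached after \<open>m\<close> columns.\<close>

definition cuts :: "nat \<Rightarrow> nat \<Rightarrow> nat \<Rightarrow> (column list \<times> column list) set" where
  "cuts N k m = {(u, v). suffixes_neg u \<and> prefixes_nonneg v \<and> length u = m \<and> u @ v \<in> bridges N k}"

lemma bridges_mset: "mset c = mset c' \<Longrightarrow> c \<in> bridges N k \<longleftrightarrow> c' \<in> bridges N k"
  unfolding bridges_def mem_Collect_eq by (metis count_mset mset_map size_mset)

lemma card_dips_eq: "card {c \<in> bridges N k. dips c = m} = card (cuts N k m)"
proof -
  have "bij_betw rearr {c \<in> bridges N k. dips c = m} (cuts N k m)"
  proof (rule bij_betw_imageI)
    show "inj_on rearr {c \<in> bridges N k. dips c = m}"
      by (auto intro: inj_onI rearr_inj)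
    show "rearr ` {c \<in> bridges N k. dips c = m} = cuts N k m"
    proof (intro equalityI subsetI)
      fix uv assume "uv \<in> rearr ` {c \<in> bridges N k. dips c = m}"
      then obtain c where "uv = rearr c" "c \<in> bridges N k" "dips c = m" by auto
      then show "uv \<in> cuts N k m"
        using rearr_parts[of c] length_rearr[of c] bridges_mset[OF rearr_mset[of c]]
        by (auto simp: cuts_def)
    next
      fix uv assume uv: "uv \<in> cuts N k m"
      obtain u v where [simp]: "uv = (u, v)" by (cases uv)
      obtain c where c: "rearr c = (u, v)" using uv rearr_surj[of u v] by (auto simp: cuts_def)
      then have "c \<in> bridges N k" "dips c = m"
        using uv length_rearr[of c] bridges_mset[OF rearr_mset[of c]] by (auto simp: cuts_def)
      then show "uv \<in> rearr ` {c \<in> bridges N k. dips c = m}" using c by force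
    qed
  qed
  then show ?thesis by (rule bij_betw_same_card)
qed

section \<open>Rotation at the first minimum\<close>

abbreviation up :: column where "up \<equiv> (True, False)"
abbreviation down :: column where "down \<equiv> (False, True)"

text \<open>The step that is split off is the one that leaves 0 for the last time.\<close>

lemma last_zero_split:
  "prefixes_nonneg g \<Longrightarrow> 1 \<le> tot g \<Longrightarrow> \<exists>X Y. g = X @ up # Y \<and> tot X = 0 \<and> prefixes_nonneg X \<and> prefixes_nonneg Y"
proof (induction g rule: rev_induct)
  case (snoc s g)
  have g: "prefixes_nonneg g" using snoc by (auto simp: prefixes_nonneg_snoc)
  show ?case
  proof (cases "1 \<le> tot g")
    case True
    then obtain X Y where "g = X @ up # Y" "tot X = 0" "prefixes_nonneg X" "prefixes_nonneg Y"
      using snoc g by blast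
    then show ?thesis using snoc.prems
      by (intro exI[of _ X] exI[of _ "Y @ [s]"]) (auto simp: prefixes_nonneg_snoc)
  next
    case False
    then have "tot g = 0" using prefixes_nonneg_tot[OF g] by simp
    moreover have "s = up" using snoc.prems \<open>tot g = 0\<close> by (cases s; cases "fst s"; cases "snd s") auto
    ultimately have "g @ [s] = g @ up # [] \<and> tot g = 0 \<and> prefixes_nonneg g \<and> prefixes_nonneg []" using g by simp
    then show ?thesis by blast
  qed
qed simp

lemma last_zero_unique:
  assumes "X @ up # Y = X' @ up # Y'" "tot X = 0" "tot X' = 0" "prefixes_nonneg Y" "prefixes_nonneg Y'"
  shows "X = X' \<and> Y = Y'"
proof -
  have *: "Z = []" if "up # Y = Z @ up # Y'" "tot Z = 0" "prefixes_nonneg Y" for Z Y Y'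
  proof (rule ccontr)
    assume "Z \<noteq> []"
    with that obtain Z' where "Z = up # Z'" "Y = Z' @ up # Y'" by (cases Z) auto
    then show False using that prefixes_nonneg_D[of Z'] by auto
  qed
  obtain Z where "X = X' @ Z \<and> Z @ up # Y = up # Y' \<or> X' = X @ Z \<and> up # Y = Z @ up # Y'"
    using assms(1) unfolding append_eq_append_conv2 by metis
  then have "Z = []"
  proof
    assume Z: "X = X' @ Z \<and> Z @ up # Y = up # Y'"
    show "Z = []" by (rule *[of Y' Z Y]) (use Z assms in auto)
  next
    assume Z: "X' = X @ Z \<and> up # Y = Z @ up # Y'"
    show "Z = []" by (rule *[of Y Z Y']) (use Z assms in auto)
  qed
  then show ?thesis using assms(1) \<open>_ \<or> _\<close> by auto
qed

text \<open>
  Both parameters refer to the walk that joins \<open>X\<close> and \<open>Y\<close> by an up step, which contributes one column and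
  one entry \<open>True\<close>.
\<close>

definition excursion_pairs :: "nat \<Rightarrow> nat \<Rightarrow> (column list \<times> column list) set" where
  "excursion_pairs N k = {(X, Y). prefixes_nonneg X \<and> prefixes_nonneg Y \<and> tot X = 0 \<and> tot Y = 0 \<and>
     Suc (length X + length Y) = N \<and> Suc (trues (map fst X) + trues (map fst Y)) = k}"

definition meanders_to_one :: "nat \<Rightarrow> nat \<Rightarrow> column list set" where
  "meanders_to_one M k = {g. prefixes_nonneg g \<and> tot g = 1 \<and> length g = M \<and> trues (map fst g) = k}"

lemma join_inj: "inj_on (\<lambda>(X, Y). X @ up # Y) (excursion_pairs M k)"
  by (auto simp: inj_on_def excursion_pairs_def dest: last_zero_unique)

lemma join_nonneg: "prefixes_nonneg X \<Longrightarrow> tot X = 0 \<Longrightarrow> prefixes_nonneg Y \<Longrightarrow> prefixes_nonneg (X @ up # Y)"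
  using prefixes_nonneg_append[of X "up # Y"] by (auto simp: Cons_eq_append_conv prefixes_nonneg_def)

lemma bij_join: "bij_betw (\<lambda>(X, Y). X @ up # Y) (excursion_pairs M k) (meanders_to_one M k)"
proof (rule bij_betw_imageI[OF join_inj], intro equalityI subsetI)
  fix g assume "g \<in> (\<lambda>(X, Y). X @ up # Y) ` excursion_pairs M k"
  then show "g \<in> meanders_to_one M k"
    by (auto simp: excursion_pairs_def meanders_to_one_def join_nonneg)
next
  fix g assume g: "g \<in> meanders_to_one M k"
  then obtain X Y where "g = X @ up # Y" "tot X = 0" "prefixes_nonneg X" "prefixes_nonneg Y"
    using last_zero_split[of g] by (auto simp: meanders_to_one_def)
  then show "g \<in> (\<lambda>(X, Y). X @ up # Y) ` excursion_pairs M k"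
    using g by (auto simp: excursion_pairs_def meanders_to_one_def image_iff)
qed

lemma finite_excursion_pairs: "finite (excursion_pairs M k)"
proof -
  have "finite {g :: column list. length g = M}"
    using finite_lists_length_eq[of "UNIV :: column set" M] by simp
  then have "finite (meanders_to_one M k)" by (rule rev_finite_subset) (auto simp: meanders_to_one_def)
  then show ?thesis using bij_betw_finite[OF bij_join] by blast
qed

text \<open>
  Let the first part of the cut end with the down step that reaches the minimum. Exchange the two
  parts and drop this step: the result starts at the minimum, never goes below it, ends one level above it,
  and is above the minimum from the end of the first \<open>N - m\<close> columns on. The last of these conditions says
  that the step which leaves the minimum for the last time is among those columns. Splitting at that step
  leaves two excursions, of which the first is shorter than \<open>N - m\<close>; nothing else depends on \<open>m\<close>.
\<close>

lemma card_cuts: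
  assumes "1 \<le> m" "m \<le> N"
  shows "card (cuts N k m) = card {(X, Y) \<in> excursion_pairs (N - 1) k. length X < N - m}"
proof -
  define r where "r = N - m"
  define \<phi> where "\<phi> = (\<lambda>g. (drop r g @ [down], take r g))"
  have inj\<phi>: "inj \<phi>" unfolding \<phi>_def by (rule injI) (metis append_same_eq append_take_drop_id prod.inject)
  let ?A = "{(X, Y) \<in> excursion_pairs (N - 1) k. length X < r}"
  have "bij_betw (\<phi> \<circ> (\<lambda>(X, Y). X @ up # Y)) ?A (cuts N k m)"
  proof (rule bij_betw_imageI)
    show "inj_on (\<phi> \<circ> (\<lambda>(X, Y). X @ up # Y)) ?A"
      by (rule comp_inj_on[OF inj_on_subset[OF join_inj] inj_on_subset[OF inj\<phi>]]) auto
    show "(\<phi> \<circ> (\<lambda>(X, Y). X @ up # Y)) ` ?A = cuts N k m"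
    proof (intro equalityI subsetI)
      fix uv assume "uv \<in> (\<phi> \<circ> (\<lambda>(X, Y). X @ up # Y)) ` ?A"
      then obtain X Y where XY: "(X, Y) \<in> excursion_pairs (N - 1) k" "length X < r"
        and uv: "uv = \<phi> (X @ up # Y)" by auto
      define g where "g = X @ up # Y"
      have g: "g \<in> meanders_to_one (N - 1) k" using XY bij_join bij_betwE g_def by fastforce
      define Y1 Y2 where "Y1 = take (r - Suc (length X)) Y" and "Y2 = drop (r - Suc (length X)) Y"
      have Y: "Y = Y1 @ Y2" by (simp add: Y1_def Y2_def)
      have split: "take r g = X @ up # Y1" "drop r g = Y2"
        using XY(2) by (auto simp: g_def Y1_def Y2_def take_Cons' drop_Cons')
      have "tot z \<le> 0" if "Y2 = y @ z" for y z
        using XY(1) that prefixes_nonneg_D[of "Y1 @ y" z] by (auto simp: excursion_pairs_def Y)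
      then have "suffixes_neg (drop r g @ [down])" unfolding split suffixes_neg_snoc_down by blast
      moreover have "prefixes_nonneg (take r g)"
        using g prefixes_nonneg_append[of "take r g" "drop r g"] by (simp add: meanders_to_one_def)
      moreover have "length (drop r g @ [down]) = m"
        using g assms by (simp add: meanders_to_one_def r_def)
      moreover have "(drop r g @ [down]) @ take r g \<in> bridges N k"
      proof -
        have "mset ((drop r g @ [down]) @ take r g) = mset (g @ [down])"
          by (metis (no_types, lifting) append_take_drop_id mset_append union_ac(1) union_ac(2))
        moreover have "g @ [down] \<in> bridges N k"
          using g assms by (auto simp: meanders_to_one_def bridges_def tot_def)
        ultimately show ?thesis using bridges_mset by blast
      qed
      ultimately show "uv \<in> cuts N k m" by (simp add: uv \<phi>_def g_def[symmetric] cuts_def)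
    next
      fix uv assume uv: "uv \<in> cuts N k m"
      then obtain u v where uv_eq: "uv = (u, v)" and u: "suffixes_neg u" "length u = m" and v: "prefixes_nonneg v"
        and br: "u @ v \<in> bridges N k" by (auto simp: cuts_def)
      then obtain x where x: "u = x @ [down]" using suffixes_neg_imp_snoc_down[of u] assms by force
      have len: "length v = r" "Suc (length x) = m"
        using br u x by (auto simp: bridges_def r_def)
      have tot: "tot v + tot x = 1" using br x by (simp add: bridges_def tot_def)
      have suffix: "tot z \<le> 0" if "x = y @ z" for y z
        using u that unfolding x suffixes_neg_snoc_down by blast
      define g where "g = v @ x"
      have "0 \<le> tot v + tot y" if "x = y @ z" for y z
        using suffix[OF that] tot that by simp
      then have "prefixes_nonneg g" using v by (auto simp: g_def prefixes_nonneg_append)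
      moreover have "tot g = 1" using tot by (simp add: g_def)
      moreover have "length g = N - 1" "trues (map fst g) = k"
        using br x by (auto simp: bridges_def g_def)
      ultimately have g: "g \<in> meanders_to_one (N - 1) k" by (simp add: meanders_to_one_def)
      then have "g \<in> (\<lambda>(X, Y). X @ up # Y) ` excursion_pairs (N - 1) k"
        by (simp only: bij_betw_imp_surj_on[OF bij_join])
      then obtain X Y where XY: "(X, Y) \<in> excursion_pairs (N - 1) k" "g = X @ up # Y"
        by auto
      have "length X < r"
      proof (rule ccontr)
        assume "\<not> length X < r"
        then obtain y where "X = v @ y" "x = y @ up # Y"
          using XY(2) len unfolding g_def append_eq_append_conv2 by fastforce
        then show False using suffix[of y "up # Y"] tot XY(1) by (auto simp: excursion_pairs_def)
      qed
      moreover have "\<phi> g = uv" using len by (simp add: \<phi>_def g_def uv_eq x)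
      ultimately show "uv \<in> (\<phi> \<circ> (\<lambda>(X, Y). X @ up # Y)) ` ?A"
        using XY by (force simp: image_iff)
    qed
  qed
  then show ?thesis unfolding r_def by (metis (no_types, lifting) bij_betw_same_card)
qed

text \<open>
  The second summand counts the pairs whose first excursion is shorter than \<open>m - 1\<close>. As the lengths of
  the two excursions add up to \<open>N - 2\<close>, exchanging them gives exactly the pairs that the first summand misses.
\<close>

lemma card_dips_add:
  assumes "1 \<le> m" "m \<le> N"
  shows "card {c \<in> bridges N k. dips c = m} + card {c \<in> bridges N k. dips c = Suc N - m} =
     card (meanders_to_one (N - 1) k)"
proof -
  let ?E = "excursion_pairs (N - 1) k"
  have "card {(X, Y) \<in> ?E. length X < N - (Suc N - m)} = card {(X, Y) \<in> ?E. \<not> length X < N - m}"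
    by (rule bij_betw_same_card[of prod.swap], rule bij_betw_byWitness[where f' = prod.swap])
      (use assms in \<open>auto simp: excursion_pairs_def\<close>)
  moreover have "card ?E = card {(X, Y) \<in> ?E. length X < N - m} + card {(X, Y) \<in> ?E. \<not> length X < N - m}"
  proof -
    let ?A = "{(X, Y) \<in> ?E. length X < N - m}" and ?B = "{(X, Y) \<in> ?E. \<not> length X < N - m}"
    have "finite ?A" "finite ?B"
      by (rule finite_subset[OF _ finite_excursion_pairs]; blast)+
    moreover have "?A \<inter> ?B = {}" by blast
    ultimately have "card (?A \<union> ?B) = card ?A + card ?B" by (rule card_Un_disjoint)
    moreover have "?A \<union> ?B = ?E" by blast
    ultimately show ?thesis by simp
  qed
  moreover have "card ?E = card (meanders_to_one (N - 1) k)"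
    by (rule bij_betw_same_card[OF bij_join])
  moreover have "1 \<le> Suc N - m" "Suc N - m \<le> N" using assms by linarith+
  ultimately show ?thesis
    using card_cuts[of m N k] card_cuts[of "Suc N - m" N k] assms by (simp add: card_dips_eq)
qed

section \<open>Counting nonnegative walks\<close>

text \<open>
  Integer arguments spare the recurrences a special case at 0: for a negative argument both
  the count and the binomial coefficient vanish.
\<close>

definition nonneg_count :: "nat \<Rightarrow> int \<Rightarrow> int \<Rightarrow> nat" where
  "nonneg_count M a b = card {g. prefixes_nonneg g \<and> length g = M \<and>
     int (trues (map fst g)) = a \<and> int (trues (map snd g)) = b}"

definition int_binom :: "nat \<Rightarrow> int \<Rightarrow> int" where
  "int_binom M a = (if a < 0 then 0 else int (M choose nat a))"

lemma int_binom_0: "int_binom 0 a = of_bool (a = 0)"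
  by (auto simp: int_binom_def)

lemma int_binom_Suc: "int_binom (Suc M) a = int_binom M a + int_binom M (a - 1)"
proof (cases "0 < a")
  case True
  then have "nat a = Suc (nat (a - 1))" by linarith
  then show ?thesis using True by (simp add: int_binom_def)
qed (auto simp: int_binom_def)

lemma nonneg_count_0: "nonneg_count 0 a b = of_bool (a = 0 \<and> b = 0)"
proof -
  have "{g. prefixes_nonneg g \<and> length g = 0 \<and> int (trues (map fst g)) = a \<and> int (trues (map snd g)) = b} =
      (if a = 0 \<and> b = 0 then {[]} else {})" by auto
  then show ?thesis by (simp add: nonneg_count_def)
qed

lemma nonneg_count_less: "a < b \<Longrightarrow> nonneg_count M a b = 0"
proof -
  assume "a < b"
  then have "{g. prefixes_nonneg g \<and> length g = M \<and>
      int (trues (map fst g)) = a \<and> int (trues (map snd g)) = b} = {}"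
    using prefixes_nonneg_tot by (force simp: tot_def)
  then show ?thesis unfolding nonneg_count_def by (simp only: card.empty)
qed

text \<open>
  The summands belong to the four possible last columns. Removing the last column gives a nonnegative
  walk; the hypothesis says that, conversely, appending it does not lead below 0.
\<close>

lemma nonneg_count_Suc:
  assumes "b \<le> a"
  shows "nonneg_count (Suc M) a b = nonneg_count M a b + nonneg_count M (a - 1) b +
     nonneg_count M a (b - 1) + nonneg_count M (a - 1) (b - 1)"
proof -
  define W where "W = (\<lambda>M a b. {g. prefixes_nonneg g \<and> length g = M \<and>
     int (trues (map fst g)) = a \<and> int (trues (map snd g)) = b})"
  have fin: "finite (W M a b)" for M a b
    by (rule finite_subset[OF _ finite_lists_length_eq[of "UNIV :: column set" M]])
      (auto simp: W_def)
  define f where "f = (\<lambda>x y (g :: column list). g @ [(x, y)])"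
  have inj: "inj_on (f x y) A" for x y A by (auto simp: inj_on_def f_def)
  have "W (Suc M) a b = f False False ` W M a b \<union> f True False ` W M (a - 1) b \<union>
      f False True ` W M a (b - 1) \<union> f True True ` W M (a - 1) (b - 1)" (is "_ = ?R")
  proof (intro equalityI subsetI)
    fix g assume g: "g \<in> W (Suc M) a b"
    then obtain h x y where h: "g = h @ [(x, y)]" by (cases g rule: rev_cases) (auto simp: W_def)
    show "g \<in> ?R" using g unfolding h
      by (cases x; cases y) (auto simp: W_def f_def prefixes_nonneg_snoc)
  next
    fix g assume "g \<in> ?R"
    then show "g \<in> W (Suc M) a b"
      using assms by (auto simp: W_def f_def prefixes_nonneg_snoc tot_def)
  qed
  moreover have "card ?R = card (W M a b) + card (W M (a - 1) b) + card (W M a (b - 1)) +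
      card (W M (a - 1) (b - 1))"
  proof -
    have "f x y ` A \<inter> f x' y' ` B = {}" if "(x, y) \<noteq> (x', y')" for x y x' y' A B
      using that by (auto simp: f_def)
    then show ?thesis
      by (subst card_Un_disjoint, simp add: fin, simp add: fin, simp add: Int_Un_distrib2)+
        (simp add: card_image inj)
  qed
  ultimately show ?thesis by (simp add: nonneg_count_def W_def)
qed

text \<open>
  This is the formula of the reflection principle. Both sides satisfy the same recurrence and vanish on the
  line \<open>b = a + 1\<close>, just outside the region of possible end points.
\<close>

lemma nonneg_count_eq:
  "b \<le> a + 1 \<Longrightarrow> int (nonneg_count M a b) = int_binom M a * int_binom M b - int_binom M (a + 1) * int_binom M (b - 1)"
proof (induction M arbitrary: a b)
  case 0
  then show ?case by (auto simp: nonneg_count_0 int_binom_0)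
next
  case (Suc M)
  show ?case
  proof (cases "b = a + 1")
    case True
    then show ?thesis by (simp add: nonneg_count_less)
  next
    case False
    then have "b \<le> a" using Suc by simp
    then show ?thesis
      by (simp add: nonneg_count_Suc Suc.IH int_binom_Suc algebra_simps)
  qed
qed

lemma real_choose_Suc:
  assumes "j \<le> M"
  shows "real (Suc j) * real (M choose Suc j) = (real M - real j) * real (M choose j)"
proof -
  have "Suc j * (M choose Suc j) = (M - j) * (M choose j)"
  proof (cases M)
    case (Suc l)
    then show ?thesis
      by (simp only: Suc_times_binomial binomial_absorb_comp diff_Suc_1)
  qed (use assms in simp)
  then show ?thesis using assms by (metis of_nat_diff of_nat_mult)
qed

lemma card_meanders_to_one:
  assumes "1 \<le> k" "k \<le> Suc M"
  shows "real (card (meanders_to_one M k)) =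
    2 / real (Suc M) * real (Suc M choose (k - 1)) * real (Suc M choose (k + 1))"
proof -
  have "meanders_to_one M k = {g. prefixes_nonneg g \<and> length g = M \<and>
     int (trues (map fst g)) = int k \<and> int (trues (map snd g)) = int k - 1}"
    by (auto simp: meanders_to_one_def tot_def)
  then have "int (card (meanders_to_one M k)) = int (nonneg_count M (int k) (int k - 1))"
    by (simp add: nonneg_count_def)
  also have "\<dots> = int (M choose k) * int (M choose (k - 1)) - int (M choose (k + 1)) * int_binom M (int k - 2)"
    using assms by (subst nonneg_count_eq) (auto simp: int_binom_def nat_diff_distrib nat_add_distrib)
  finally have "real_of_int (int (card (meanders_to_one M k))) = real_of_int (int (M choose k) *
      int (M choose (k - 1)) - int (M choose (k + 1)) * int_binom M (int k - 2))" by (rule arg_cong)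
  then have card: "real (card (meanders_to_one M k)) = real (M choose k) * real (M choose (k - 1)) -
      real (M choose (k + 1)) * real_of_int (int_binom M (int k - 2))" by simp
  \<comment> \<open>Pascal's rule turns the right-hand side into a multiple of \<open>(w + x) * (y + z)\<close>. As \<open>w\<close> is a rational
    multiple of \<open>x\<close>, and \<open>z\<close> of \<open>y\<close>, the claim is an identity of rational functions times \<open>x * y\<close>.\<close>
  define w x y z where "w = real_of_int (int_binom M (int k - 2))" and "x = real (M choose (k - 1))"
    and "y = real (M choose k)" and "z = real (M choose (k + 1))"
  obtain j where k: "k = Suc j" using assms by (cases k) auto
  have j: "j \<le> M" using assms k by simp
  have wx: "(real M - real j + 1) * w = real j * x"
  proof (cases j)
    case 0 then show ?thesis by (simp add: w_def int_binom_def k)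
  next
    case (Suc i)
    have "int_binom M (int k - 2) = int (M choose i)" by (simp add: int_binom_def k Suc)
    then show ?thesis
      using real_choose_Suc[of i M] j Suc by (simp add: w_def x_def k)
  qed
  have yz: "(real j + 2) * z = (real M - real j - 1) * y"
  proof (cases "k \<le> M")
    case True
    then show ?thesis using real_choose_Suc[OF True] by (simp add: y_def z_def k algebra_simps)
  next
    case False
    then have "j = M" using j k by simp
    then show ?thesis by (simp add: y_def z_def k binomial_eq_0)
  qed
  have left: "real (Suc M choose (k - 1)) = w + x"
    by (cases j) (auto simp: w_def x_def int_binom_def k)
  have right: "real (Suc M choose (k + 1)) = y + z"
    by (simp add: y_def z_def k)
  have p: "real M - real j + 1 > 0" "real j + 2 > 0" using j by auto
  have w: "w = real j * x / (real M - real j + 1)" and z: "z = (real M - real j - 1) * y / (real j + 2)"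
    using wx yz p by (simp_all add: field_simps)
  have "(real M + 1) * (y * x - z * w) = 2 * (w + x) * (y + z)"
    unfolding w z using p by (simp add: divide_simps) algebra
  then have "y * x - z * w = 2 / real (Suc M) * (w + x) * (y + z)"
    by (simp add: field_simps)
  then show ?thesis unfolding left right card by (simp add: w_def x_def y_def z_def)
qed

section \<open>The counting theorem\<close>

theorem corollary7:
  fixes n m k :: nat
  assumes "1 \<le> m" and "m \<le> n - 2" and "1 \<le> k" and "k \<le> n - 1"
  shows "p D U n m k + p U D n m (k + 1) = p D U n (m + 1) k + p U D n (m + 1) (k + 1) \<and>
         real (p D U n (m + 1) k + p U D n (m + 1) (k + 1)) =
           2 / (real n - 1) * real ((n - 1) choose (k - 1)) * real ((n - 1) choose (k + 1))"
proof -
  obtain M where n: "n = Suc (Suc M)" using assms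
    by (metis add_2_eq_Suc le_Suc_ex diff_is_0_eq le_zero_eq nat_le_linear not_one_le_zero)
  have "p D U n i k + p U D n i (k + 1) = card (meanders_to_one M k)" if "1 \<le> i" "i \<le> Suc M" for i
    using card_dips_add[OF that, of k] that by (simp add: n p_UD p_DU)
  moreover have "1 \<le> m" "m \<le> Suc M" "1 \<le> m + 1" "m + 1 \<le> Suc M" using assms n by auto
  ultimately have "p D U n m k + p U D n m (k + 1) = card (meanders_to_one M k)"
    "p D U n (m + 1) k + p U D n (m + 1) (k + 1) = card (meanders_to_one M k)" by blast+
  then show ?thesis using card_meanders_to_one[of k M] assms n by simp
qed

end
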